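(* Let $X\subset\mathcal A^{\mathbb N}$, $\mathcal A=\{1,\dots,d\}$, be a $C$-balanced subshift. If $(w^{(n)})_n$ is a sequence in $X$ that converges to a $w\in X$ with dense shift-orbit in $X$, then $\mathcal R_a(w^{(n)})\to\mathcal R_a(w)$ in the Hausdorff metric as $n\to\infty$, for all $a\in\mathcal A$.
   Context: $\mathcal A^{\mathbb N}$ has the product topology, $S$ is the left shift, and a subshift is a closed set $X\subset\mathcal A^{\mathbb N}$ with $S(X)=X$; the shift-orbit of $w$ is $\{S^nw:n\ge0\}$. A sequence $x$ is $C$-balanced if there is a constant $C\ge1$ such that $\bigl||x_{[j,j+n-1]}|_a-|x_{[k,k+n-1]}|_a\bigr|\le C$ for all $j,k,n\in\mathbb N$, $a\in\mathcal A$, where $x_{[i,j]}=x_i\cdots x_j$ (empty if $j<i$) and $|u|_a$ is the number of occurrences of $a$ in $u$. A subshift is $C$-balanced if each of its elements is $C$-balanced. Since $X$ contains a point with dense shift-orbit, all elements of $X$ have the same letter frequency vector $\mathbf v$, $v_i=\lim_{n\to\infty}\frac1n|x_{[1,n]}|_i$. $\mathbb H\subset\mathbb R^d$ is a fixed $(d-1)$-dimensional linear hyperplane not containing $\mathbf v$ (with the metric induced by a norm), and $\pi$ is the linear projection along $\mathbf v$ onto $\mathbb H$. With $\psi(u)=(|u|_1,\dots,|u|_d)^T$, for $x\in X$: $\mathcal S_a(x)=\{\psi(x_{[1,n]}):n\ge0,\ x_{n+1}=a\}$ and $\mathcal R_a(x)=\overline{\pi(\mathcal S_a(x))}$, a compact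 set. (If the letter $a$ does not occur in $w$, it occurs in no element of $X$, all the sets are empty and the claim is void.) *)

theory Defs
  imports "HOL-Analysis.Analysis" "HOL-Library.Extended_Nonnegative_Real"
begin

text \<open>
  The alphabet \<open>{1, \<dots>, d}\<close> is a finite type \<open>'d\<close> with \<open>d = CARD('d)\<close>. A one-sided sequence
  \<open>x\<^sub>1 x\<^sub>2 \<dots>\<close> is a function \<open>x :: nat \<Rightarrow> 'd\<close> with indices shifted by one: \<open>x i\<close> is \<open>x\<^sub>i\<^sub>+\<^sub>1\<close>.
\<close>

definition fullshift :: "(nat \<Rightarrow> 'd) topology" where
  "fullshift = product_topology (\<lambda>_. discrete_topology UNIV) UNIV"

definition shift :: "(nat \<Rightarrow> 'd) \<Rightarrow> nat \<Rightarrow> 'd" where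
  "shift x = (\<lambda>n. x (Suc n))"

definition subshift :: "(nat \<Rightarrow> 'd) set \<Rightarrow> bool" where
  "subshift X \<longleftrightarrow> closedin fullshift X \<and> shift ` X = X"

definition shift_orbit :: "(nat \<Rightarrow> 'd) \<Rightarrow> (nat \<Rightarrow> 'd) set" where
  "shift_orbit w = {(shift ^^ n) w | n. True}"

text \<open>\<open>factor x j n\<close> is the factor of length \<open>n\<close> of \<open>x\<close> that starts after its first \<open>j\<close> letters.\<close>

definition factor :: "(nat \<Rightarrow> 'd) \<Rightarrow> nat \<Rightarrow> nat \<Rightarrow> 'd list" where
  "factor x j n = map x [j..<j + n]"

definition balanced :: "real \<Rightarrow> (nat \<Rightarrow> 'd) \<Rightarrow> bool" where
  "balanced C x \<longleftrightarrow> (\<forall>j k n a.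
     \<bar>real (count_list (factor x j n) a) - real (count_list (factor x k n) a)\<bar> \<le> C)"

definition abelianization :: "'d list \<Rightarrow> real ^ 'd::finite" where
  "abelianization u = (\<chi> a. real (count_list u a))"

text \<open>
  The letter frequency vector common to all elements of \<open>X\<close>. It exists and is unique for a balanced
  subshift containing a point with dense orbit.
\<close>

definition has_letter_frequencies :: "(nat \<Rightarrow> 'd::finite) \<Rightarrow> real ^ 'd \<Rightarrow> bool" where
  "has_letter_frequencies x v \<longleftrightarrow>
     (\<forall>a. (\<lambda>n. real (count_list (factor x 0 n) a) / real n) \<longlonglongrightarrow> v $ a)"

definition letter_frequencies :: "(nat \<Rightarrow> 'd::finite) set \<Rightarrow> real ^ 'd" where
  "letter_frequencies X = (THE v. \<forall>x\<in>X. has_letter_frequencies x v)"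

text \<open>Projection onto \<open>H\<close> along \<open>v\<close>, meaningful for a hyperplane \<open>H\<close> with \<open>v \<notin> H\<close>.\<close>

definition proj_along :: "'v::real_vector \<Rightarrow> 'v set \<Rightarrow> 'v \<Rightarrow> 'v" where
  "proj_along v H y = (THE h. h \<in> H \<and> y - h \<in> span {v})"

definition prefix_points :: "'d \<Rightarrow> (nat \<Rightarrow> 'd) \<Rightarrow> (real ^ 'd::finite) set" where
  "prefix_points a x = {abelianization (factor x 0 n) | n. x n = a}"

text \<open>
  The Euclidean closure is also the closure in \<open>H\<close> for the metric of any norm on \<open>H\<close>, since \<open>H\<close> is
  closed and all norms on \<open>H\<close> are equivalent.
\<close>

definition rauzy_subtile ::
  "real ^ 'd \<Rightarrow> (real ^ 'd) set \<Rightarrow> 'd \<Rightarrow> (nat \<Rightarrow> 'd) \<Rightarrow> (real ^ 'd::finite) set" where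
  "rauzy_subtile v H a x = closure (proj_along v H ` prefix_points a x)"

definition norm_on :: "'v::real_vector set \<Rightarrow> ('v \<Rightarrow> real) \<Rightarrow> bool" where
  "norm_on H N \<longleftrightarrow>
     (\<forall>x\<in>H. 0 \<le> N x \<and> (N x = 0 \<longleftrightarrow> x = 0) \<and> (\<forall>c. N (c *\<^sub>R x) = \<bar>c\<bar> * N x)) \<and>
     (\<forall>x\<in>H. \<forall>y\<in>H. N (x + y) \<le> N x + N y)"

text \<open>
  Hausdorff distance for the metric \<open>(x, y) \<mapsto> N (x - y)\<close>. With values in \<open>ennreal\<close>, the distance
  between two empty sets is \<open>0\<close>, and that between an empty and a nonempty set is \<open>\<infinity>\<close>.
\<close>

definition hausdorff_distance :: "('v::real_vector \<Rightarrow> real) \<Rightarrow> 'v set \<Rightarrow> 'v set \<Rightarrow> ennreal" where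
  "hausdorff_distance N A B =
     max (SUP x\<in>A. INF y\<in>B. ennreal (N (x - y))) (SUP y\<in>B. INF x\<in>A. ennreal (N (x - y)))"

end

theory Submission
  imports Defs
begin

text \<open>
  Write \<open>\<pi>\<close> for the projection along the frequency vector \<open>v\<close> and \<open>s\<^sub>n(x)\<close> for the image under \<open>\<pi>\<close> of
  the abelianized prefix of length \<open>n\<close> of \<open>x\<close>. Since \<open>\<pi>\<close> is linear, \<open>s\<^sub>n(x)\<close> is a sum of one vector per
  letter (\<open>letter_sum\<close>), so it is a cocycle: if \<open>x\<^sub>1 \<dots> x\<^sub>n\<close> occurs in \<open>w\<close> after its first \<open>p\<close> letters,
  then \<open>s\<^sub>p\<^sub>+\<^sub>n(w) = s\<^sub>p(w) + s\<^sub>n(x)\<close>. Balance keeps the letter counts of prefixes of \<open>w\<close> within a bounded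
  distance of \<open>n v\<close> (\<open>letter_frequencies_near_linear\<close>), and \<open>\<pi>\<close> kills \<open>v\<close>, so the sums \<open>s\<^sub>n(w)\<close> are
  bounded.

  The point is that a bounded cocycle is small at returns to \<open>w\<close>: if \<open>w\<close> reappears after \<open>p\<close> letters
  along a sufficiently long prefix, then \<open>s\<^sub>p(w)\<close> is small (\<open>letter_sum_return_norm_less\<close>). For a real
  cocycle, choose \<open>K\<close> such that \<open>s\<^sub>K(w)\<close> is within \<open>\<epsilon>\<close> of the supremum of all \<open>s\<^sub>n(w)\<close>; if the prefix of
  length \<open>K\<close> reappears after \<open>p\<close> letters, then \<open>s\<^sub>p(w) + s\<^sub>K(w)\<close> does not exceed the supremum, and so
  \<open>s\<^sub>p(w) < \<epsilon>\<close>. The vector case is this bound in each coordinate direction and its opposite.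

  Now let \<open>x\<close> in \<open>X\<close> share a long prefix with \<open>w\<close>. Every prefix of \<open>x\<close> occurs in \<open>w\<close> because the orbit of
  \<open>w\<close> is dense, and its occurrence can be taken together with the prefix shared with \<open>w\<close>. So the
  position \<open>p\<close> of the occurrence is a return, and \<open>s\<^sub>n(x)\<close> is close to \<open>s\<^sub>p\<^sub>+\<^sub>n(w)\<close>, a point of the same
  subtile of \<open>w\<close> (\<open>letter_sums_upper_semicontinuous\<close>). Conversely, the points of a subtile of \<open>w\<close> form a
  bounded set, so finitely many of them are nearly dense in it, and \<open>x\<close> shares these as soon as it
  shares a prefix beyond them (\<open>letter_sums_lower_semicontinuous\<close>). These two inclusions up to \<open>\<epsilon>\<close> give
  convergence for the Euclidean norm, hence for every norm on the hyperplane.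
\<close>

section \<open>Cylinders and convergence in the full shift\<close>

text \<open>
  Testing convergence and closure on cylinders turns the two topological hypotheses into statements
  about finite words.
\<close>

lemma openin_fullshift_cylinder: "openin fullshift {y. \<forall>i<K. y i = x i}"
proof -
  have "{y. \<forall>i<K. y i = x i} = (\<Pi>\<^sub>E i\<in>UNIV. if i < K then {x i} else UNIV)"
    by (auto simp: PiE_def Pi_def split: if_splits)
  moreover have "finite {i. (if i < K then {x i} else UNIV) \<noteq> UNIV}"
    by (rule finite_subset[of _ "{..<K}"]) (auto split: if_splits)
  ultimately show ?thesis
    unfolding fullshift_def by (auto intro!: product_topology_basis)
qed

lemma limitin_fullshift_prefix:
  assumes "limitin fullshift ws w F"
  shows "\<forall>\<^sub>F n in F. \<forall>i<K. ws n i = w i"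
proof -
  have "w \<in> {y. \<forall>i<K. y i = w i}"
    by simp
  with assms openin_fullshift_cylinder[of K w]
  have "\<forall>\<^sub>F n in F. ws n \<in> {y. \<forall>i<K. y i = w i}"
    unfolding limitin_def by blast
  then show ?thesis
    by simp
qed

lemma funpow_shift: "(shift ^^ n) w i = w (n + i)"
  by (induction n arbitrary: i) (auto simp: shift_def)

lemma orbit_closure_prefix_occurs:
  assumes "x \<in> fullshift closure_of shift_orbit w"
  obtains p where "\<And>i. i < K \<Longrightarrow> w (p + i) = x i"
proof -
  let ?U = "{y. \<forall>i<K. y i = x i}"
  have "x \<in> ?U"
    by simp
  then have "\<exists>y. y \<in> shift_orbit w \<and> y \<in> ?U"
    using assms openin_fullshift_cylinder[of K x] by (meson in_closure_of)
  then obtain p where "\<forall>i<K. w (p + i) = x i"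
    by (auto simp: shift_orbit_def funpow_shift)
  then show ?thesis
    using that by blast
qed

section \<open>Letter frequencies\<close>

text \<open>
  Balance says that the count of a letter in prefixes is additive up to a bounded error. Such a function
  stays within the same error of a linear one: for positive \<open>m\<close> and \<open>n\<close>, both \<open>m f(n)\<close> and \<open>n f(m)\<close>
  approximate \<open>f(m n)\<close>, hence each interval with center \<open>f(n) / n\<close> and radius \<open>C / n\<close> meets every other
  one, and a slope common to all of them exists.
\<close>

lemma quasi_additive_multiple:
  fixes f :: "nat \<Rightarrow> real"
  assumes "\<And>m n. \<bar>f (m + n) - f m - f n\<bar> \<le> C"
  shows "\<bar>f (Suc m * n) - real (Suc m) * f n\<bar> \<le> real m * C"
proof (induction m)
  case (Suc m)
  have "\<bar>f (n + Suc m * n) - f n - f (Suc m * n)\<bar> \<le> C"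
    by (rule assms)
  with Suc show ?case
    by (simp add: algebra_simps abs_le_iff)
qed simp

lemma quasi_additive_near_linear:
  fixes f :: "nat \<Rightarrow> real"
  assumes quasi: "\<And>m n. \<bar>f (m + n) - f m - f n\<bar> \<le> C"
  obtains v where "\<And>n. \<bar>f n - real n * v\<bar> \<le> C"
proof -
  have C: "0 \<le> C"
    using quasi[of 0 0] by linarith
  have bound: "\<bar>f (m * n) - real m * f n\<bar> \<le> real m * C" if "0 < m" for m n
  proof -
    have "\<bar>f (m * n) - real m * f n\<bar> \<le> real (m - 1) * C"
      using quasi_additive_multiple[of f C "m - 1" n, OF quasi] that by simp
    also have "\<dots> \<le> real m * C"
      using C by (intro mult_right_mono) auto
    finally show ?thesis .
  qed
  have separated: "(f n - C) / real n \<le> (f m + C) / real m" if "0 < m" "0 < n" for m n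
  proof -
    have "real m * f n - real n * f m \<le> real m * C + real n * C"
      using bound[OF that(1), of n] bound[OF that(2), of m] by (simp add: mult.commute abs_le_iff)
    then show ?thesis
      using that by (simp add: field_simps)
  qed
  \<comment> \<open>Every left endpoint lies below every right endpoint, so the supremum of the left endpoints is in
    all the intervals.\<close>
  define v where "v = (SUP n\<in>{0<..}. (f n - C) / real n)"
  have bdd: "bdd_above ((\<lambda>n. (f n - C) / real n) ` {0<..})"
    using separated[of 1] by (intro bdd_aboveI[where M = "(f 1 + C) / real 1"]) auto
  have "\<bar>f n - real n * v\<bar> \<le> C" for n
  proof (cases "n = 0")
    case True
    then show ?thesis
      using quasi[of 0 0] by simp
  next
    case False
    have "(f n - C) / real n \<le> v"
      unfolding v_def using False by (intro cSUP_upper bdd) auto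
    moreover have "v \<le> (f n + C) / real n"
      unfolding v_def using False separated by (intro cSUP_least) auto
    ultimately show ?thesis
      using False by (simp add: field_simps abs_le_iff)
  qed
  then show ?thesis
    using that by blast
qed

lemma tendsto_divide_of_near_linear:
  fixes f :: "nat \<Rightarrow> real"
  assumes "\<And>n. \<bar>f n - real n * v\<bar> \<le> C"
  shows "(\<lambda>n. f n / real n) \<longlonglongrightarrow> v"
proof (rule LIM_zero_cancel, rule Lim_null_comparison)
  show "\<forall>\<^sub>F n in sequentially. norm (f n / real n - v) \<le> C / real n"
    using eventually_gt_at_top[of 0]
  proof eventually_elim
    case (elim n)
    then have "f n / real n - v = (f n - real n * v) / real n"
      by (simp add: field_simps)
    then show ?case
      using assms[of n] by (simp add: divide_right_mono)
  qed
  show "(\<lambda>n. C / real n) \<longlonglongrightarrow> 0"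
    by (rule lim_const_over_n)
qed

lemma count_factor_add:
  "count_list (factor x 0 (m + n)) a = count_list (factor x 0 m) a + count_list (factor x m n) a"
  by (simp add: factor_def upt_add_eq_append[of 0 m n, simplified])

text \<open>
  The linear approximation along \<open>w\<close> carries over to each \<open>x\<close> in \<open>X\<close> with twice the error, because the
  prefixes of \<open>x\<close> occur in \<open>w\<close>. So the slopes found for \<open>w\<close> are the frequencies of all elements of \<open>X\<close>,
  which identifies the definite description in \<^const>\<open>letter_frequencies\<close>.
\<close>

lemma letter_frequencies_near_linear:
  fixes w :: "nat \<Rightarrow> 'd::finite"
  assumes w: "w \<in> X" and bal: "balanced C w"
    and dense: "X \<subseteq> fullshift closure_of shift_orbit w"
  shows "\<bar>real (count_list (factor w 0 n) a) - real n * letter_frequencies X $ a\<bar> \<le> C"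
proof -
  have bal': "\<bar>real (count_list (factor w j n) a) - real (count_list (factor w k n) a)\<bar> \<le> C"
    for j k n a
    using bal unfolding balanced_def by blast
  have "\<exists>v. \<forall>n. \<bar>real (count_list (factor w 0 n) a) - real n * v\<bar> \<le> C" for a
  proof -
    have "\<bar>real (count_list (factor w 0 (m + n)) a) - real (count_list (factor w 0 m) a)
        - real (count_list (factor w 0 n) a)\<bar> \<le> C" for m n
      using bal'[of m n a 0] by (simp add: count_factor_add)
    from quasi_additive_near_linear[of "\<lambda>n. real (count_list (factor w 0 n) a)", OF this]
    show ?thesis by blast
  qed
  then obtain u
    where u: "\<And>a n. \<bar>real (count_list (factor w 0 n) a) - real n * u a\<bar> \<le> C"
    by metis
  define v :: "real ^ 'd" where "v = (\<chi> a. u a)"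
  have freq: "has_letter_frequencies x v" if "x \<in> X" for x
    unfolding has_letter_frequencies_def
  proof
    fix a
    have "\<bar>real (count_list (factor x 0 n) a) - real n * u a\<bar> \<le> 2 * C" for n
    proof -
      obtain p where p: "\<And>i. i < n \<Longrightarrow> w (p + i) = x i"
        using orbit_closure_prefix_occurs[of x w n] \<open>x \<in> X\<close> dense by blast
      have "factor x 0 n = factor w p n"
        using p by (auto simp: factor_def intro!: nth_equalityI)
      then have "\<bar>real (count_list (factor x 0 n) a) - real (count_list (factor w 0 n) a)\<bar> \<le> C"
        using bal'[of p n a 0] by simp
      then show ?thesis
        using u[of n a] by linarith
    qed
    from tendsto_divide_of_near_linear[OF this]
    show "(\<lambda>n. real (count_list (factor x 0 n) a) / real n) \<longlonglongrightarrow> v $ a"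
      by (simp add: v_def)
  qed
  have "letter_frequencies X = v"
    unfolding letter_frequencies_def
  proof (rule the_equality)
    show "\<forall>x\<in>X. has_letter_frequencies x v"
      using freq by blast
    fix v' assume "\<forall>x\<in>X. has_letter_frequencies x v'"
    then have "v' $ a = v $ a" for a
      using w freq[OF w] LIMSEQ_unique[of _ "v' $ a" "v $ a"]
      unfolding has_letter_frequencies_def by blast
    then show "v' = v"
      by (simp add: vec_eq_iff)
  qed
  then show ?thesis
    using u by (simp add: v_def)
qed

section \<open>Projection onto a hyperplane and norms on it\<close>

text \<open>
  With a normal vector \<open>c\<close> of \<open>H\<close> the projection has the closed form \<open>y - (c \<bullet> y / c \<bullet> v) v\<close>, from which
  all its properties can be read off.
\<close>

lemma proj_along_hyperplane:
  fixes v :: "'a::euclidean_space"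
  assumes "subspace H" and "dim H = DIM('a) - 1" and "v \<notin> H"
  shows "linear (proj_along v H)" and "proj_along v H y \<in> H" and "y \<in> H \<Longrightarrow> proj_along v H y = y"
    and "proj_along v H v = 0"
proof -
  obtain c where c: "c \<noteq> 0" and H: "H = {x. c \<bullet> x = 0}"
  proof -
    have "dim H < DIM('a)"
      using assms(2) by simp
    then obtain c where c: "c \<noteq> 0" "span H \<subseteq> {x. c \<bullet> x = 0}"
      using lowdim_subset_hyperplane by blast
    have "H = {x. c \<bullet> x = 0}"
      using c assms by (intro subspace_dim_equal)
        (auto simp: subspace_hyperplane dim_hyperplane span_eq_iff[THEN iffD2])
    with c show ?thesis using that by blast
  qed
  have cv: "c \<bullet> v \<noteq> 0"
    using H assms(3) by simp
  have eq: "proj_along v H y = y - ((c \<bullet> y) / (c \<bullet> v)) *\<^sub>R v" for y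
    unfolding proj_along_def
  proof (rule the_equality)
    show "y - (c \<bullet> y / (c \<bullet> v)) *\<^sub>R v \<in> H \<and> y - (y - (c \<bullet> y / (c \<bullet> v)) *\<^sub>R v) \<in> span {v}"
      using cv by (simp add: H inner_diff_right span_mul span_base)
    fix h assume h: "h \<in> H \<and> y - h \<in> span {v}"
    then obtain k where k: "y - h = k *\<^sub>R v"
      by (auto simp: span_singleton)
    then have "c \<bullet> y - c \<bullet> h = k * (c \<bullet> v)"
      by (metis inner_diff_right inner_scaleR_right)
    then have "k = c \<bullet> y / (c \<bullet> v)"
      using h cv by (simp add: H)
    with k show "h = y - (c \<bullet> y / (c \<bullet> v)) *\<^sub>R v"
      by (simp add: algebra_simps)
  qed
  show "linear (proj_along v H)"
    by (rule linearI) (simp_all add: eq inner_add_right add_divide_distrib algebra_simps)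
  show "proj_along v H y \<in> H"
    unfolding eq using cv by (simp add: H inner_diff_right)
  show "proj_along v H y = y" if "y \<in> H"
    unfolding eq using that by (simp add: H)
  show "proj_along v H v = 0"
    using cv by (simp add: eq)
qed

lemma norm_on_sum_le:
  assumes "subspace H" and N: "norm_on H N" and "finite I" and "\<And>i. i \<in> I \<Longrightarrow> f i \<in> H"
  shows "N (\<Sum>i\<in>I. f i) \<le> (\<Sum>i\<in>I. N (f i))"
  using assms(3,4)
proof (induction I rule: finite_induct)
  case empty
  have "N 0 = 0"
    using N subspace_0[OF assms(1)] unfolding norm_on_def by blast
  then show ?case
    by simp
next
  case (insert i I)
  have "N (f i + (\<Sum>i\<in>I. f i)) \<le> N (f i) + N (\<Sum>i\<in>I. f i)"
    using N insert.prems[of i] subspace_sum[OF assms(1), of I f] insert.prems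
    by (simp add: norm_on_def)
  moreover have "N (\<Sum>i\<in>I. f i) \<le> (\<Sum>i\<in>I. N (f i))"
    using insert by blast
  ultimately show ?case
    using insert.hyps by simp
qed

text \<open>
  A linear retraction \<open>p\<close> onto \<open>H\<close> maps the standard basis to vectors on which \<open>N\<close> is controlled, and
  expresses each \<open>y\<close> in \<open>H\<close> as the combination of these with the coordinates of \<open>y\<close>. Thus no basis of
  \<open>H\<close> has to be chosen.
\<close>

lemma norm_on_le_norm:
  fixes H :: "'a::euclidean_space set"
  assumes H: "subspace H" and N: "norm_on H N"
    and p: "linear p" "\<And>y. p y \<in> H" "\<And>y. y \<in> H \<Longrightarrow> p y = y"
  obtains M where "M > 0" and "\<And>y. y \<in> H \<Longrightarrow> N y \<le> M * norm y"
proof -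
  have N_scale: "N (k *\<^sub>R y) = \<bar>k\<bar> * N y" and N_pos: "0 \<le> N y" if "y \<in> H" for y k
    using N that unfolding norm_on_def by blast+
  have sum_pos: "0 \<le> (\<Sum>b\<in>Basis. N (p b))"
    using N_pos p(2) by (intro sum_nonneg) auto
  have "N y \<le> (1 + (\<Sum>b\<in>Basis. N (p b))) * norm y" if "y \<in> H" for y
  proof -
    have "y = p (\<Sum>b\<in>Basis. (y \<bullet> b) *\<^sub>R b)"
      using p(3)[OF that] by (simp add: euclidean_representation)
    also have "\<dots> = (\<Sum>b\<in>Basis. (y \<bullet> b) *\<^sub>R p b)"
      by (simp add: linear_sum[OF p(1)] linear_scale[OF p(1)])
    finally have "N y = N (\<Sum>b\<in>Basis. (y \<bullet> b) *\<^sub>R p b)"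
      by (rule arg_cong)
    also have "\<dots> \<le> (\<Sum>b\<in>Basis. N ((y \<bullet> b) *\<^sub>R p b))"
      using p(2) by (intro norm_on_sum_le[OF H N] subspace_scale[OF H]) auto
    also have "\<dots> = (\<Sum>b\<in>Basis. \<bar>y \<bullet> b\<bar> * N (p b))"
      using p(2) by (simp add: N_scale)
    also have "\<dots> \<le> (\<Sum>b\<in>Basis. norm y * N (p b))"
      using p(2) N_pos by (intro sum_mono mult_right_mono Basis_le_norm) auto
    also have "\<dots> = norm y * (\<Sum>b\<in>Basis. N (p b))"
      by (simp add: sum_distrib_left)
    also have "\<dots> \<le> (1 + (\<Sum>b\<in>Basis. N (p b))) * norm y"
      by (simp add: algebra_simps)
    finally show ?thesis .
  qed
  then show ?thesis
    using that[of "1 + (\<Sum>b\<in>Basis. N (p b))"] sum_pos by auto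
qed

text \<open>
  A point of a closure is within \<open>\<delta>\<close> of the set itself, which costs a second \<open>\<delta>\<close>. The case of empty
  sets is covered: by the last two assumptions they are empty together, and a supremum over the empty
  set is \<open>0\<close> in \<^typ>\<open>ennreal\<close>.
\<close>

lemma hausdorff_distance_closure_le:
  assumes H: "subspace (H :: 'a::euclidean_space set)" and "A \<subseteq> H" and "B \<subseteq> H"
    and N: "\<And>y. y \<in> H \<Longrightarrow> N y \<le> M * norm y" and M: "0 \<le> M" and "0 < \<delta>"
    and AB: "\<And>x. x \<in> A \<Longrightarrow> \<exists>y\<in>B. dist x y \<le> \<delta>"
    and BA: "\<And>y. y \<in> B \<Longrightarrow> \<exists>x\<in>A. dist x y \<le> \<delta>"
  shows "hausdorff_distance N (closure A) (closure B) \<le> ennreal (M * (2 * \<delta>))"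
proof -
  have closH: "closure A \<subseteq> H" "closure B \<subseteq> H"
    using \<open>A \<subseteq> H\<close> \<open>B \<subseteq> H\<close> closed_subspace[OF H] by (simp_all add: closure_minimal)
  have N_le: "N (x - y) \<le> M * (2 * \<delta>)" if "x \<in> H" "y \<in> H" "dist x y \<le> 2 * \<delta>" for x y
  proof -
    have "N (x - y) \<le> M * norm (x - y)"
      using that H by (intro N subspace_diff)
    also have "\<dots> \<le> M * (2 * \<delta>)"
      using that M by (intro mult_left_mono) (auto simp: dist_norm)
    finally show ?thesis .
  qed
  have "(INF y\<in>closure B. ennreal (N (x - y))) \<le> ennreal (M * (2 * \<delta>))" if x: "x \<in> closure A" for x
  proof -
    obtain a where a: "a \<in> A" "dist a x < \<delta>"
      using x \<open>0 < \<delta>\<close> unfolding closure_approachable by blast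
    obtain b where b: "b \<in> B" "dist a b \<le> \<delta>"
      using AB a by blast
    have "dist x b \<le> 2 * \<delta>"
      using a b dist_triangle[of x b a] by (simp add: dist_commute)
    moreover have "b \<in> closure B"
      using b closure_subset by blast
    ultimately show ?thesis
      using x closH by (intro INF_lower2[of b] ennreal_leI N_le) auto
  qed
  moreover have "(INF x\<in>closure A. ennreal (N (x - y))) \<le> ennreal (M * (2 * \<delta>))"
    if y: "y \<in> closure B" for y
  proof -
    obtain b where b: "b \<in> B" "dist b y < \<delta>"
      using y \<open>0 < \<delta>\<close> unfolding closure_approachable by blast
    obtain a where a: "a \<in> A" "dist a b \<le> \<delta>"
      using BA b by blast
    have "dist a y \<le> 2 * \<delta>"
      using a b dist_triangle[of a y b] by simp
    moreover have "a \<in> closure A"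
      using a closure_subset by blast
    ultimately show ?thesis
      using y closH by (intro INF_lower2[of a] ennreal_leI N_le) auto
  qed
  ultimately show ?thesis
    unfolding hausdorff_distance_def by (intro max.boundedI SUP_least)
qed

section \<open>Letter sums and their small returns\<close>

definition letter_sum :: "('d \<Rightarrow> 'a::comm_monoid_add) \<Rightarrow> (nat \<Rightarrow> 'd) \<Rightarrow> nat \<Rightarrow> 'a" where
  "letter_sum h x n = (\<Sum>i<n. h (x i))"

lemma letter_sum_cong:
  "(\<And>i. i < n \<Longrightarrow> x i = y i) \<Longrightarrow> letter_sum h x n = letter_sum h y n"
  by (simp add: letter_sum_def)

lemma letter_sum_add:
  "letter_sum h x (p + n) = letter_sum h x p + letter_sum h (\<lambda>i. x (p + i)) n"
  by (induction n) (simp_all add: letter_sum_def add.assoc)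

lemma abelianization_factor: "abelianization (factor x 0 n) = letter_sum (\<lambda>a. axis a 1) x n"
  by (induction n) (auto simp: letter_sum_def factor_def abelianization_def vec_eq_iff axis_def)

lemma linear_abelianization_factor:
  "linear f \<Longrightarrow> f (abelianization (factor x 0 n)) = letter_sum (\<lambda>a. f (axis a 1)) x n"
  by (simp add: abelianization_factor letter_sum_def linear_sum)

text \<open>
  A return along a prefix whose sum is almost maximal cannot have a large sum itself, since the two
  sums add up to another sum of \<open>w\<close>.
\<close>

lemma letter_sum_return_less:
  fixes h :: "'d \<Rightarrow> real"
  assumes bdd: "bdd_above (range (letter_sum h w))" and "0 < \<epsilon>"
  obtains K where "\<And>p. (\<And>i. i < K \<Longrightarrow> w (p + i) = w i) \<Longrightarrow> letter_sum h w p < \<epsilon>"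
proof -
  let ?M = "SUP n. letter_sum h w n"
  obtain K where K: "?M - \<epsilon> < letter_sum h w K"
    using less_cSUP_iff[OF _ bdd, of "?M - \<epsilon>"] \<open>0 < \<epsilon>\<close> by auto
  have "letter_sum h w p < \<epsilon>" if "\<And>i. i < K \<Longrightarrow> w (p + i) = w i" for p
  proof -
    have "letter_sum h w p + letter_sum h w K = letter_sum h w (p + K)"
      using that letter_sum_cong[of K "\<lambda>i. w (p + i)" w h] by (simp add: letter_sum_add)
    also have "\<dots> \<le> ?M"
      using bdd by (intro cSUP_upper) auto
    finally show ?thesis
      using K by simp
  qed
  then show ?thesis
    using that by blast
qed

text \<open>
  The one-sided bound is applied to the coordinates in the directions of the standard basis and in the
  opposite directions.
\<close>

lemma letter_sum_return_norm_less:
  fixes h :: "'d \<Rightarrow> 'a::euclidean_space"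
  assumes bdd: "bounded (range (letter_sum h w))" and "0 < \<epsilon>"
  obtains K where "\<And>p. (\<And>i. i < K \<Longrightarrow> w (p + i) = w i) \<Longrightarrow> norm (letter_sum h w p) < \<epsilon>"
proof -
  let ?\<delta> = "\<epsilon> / real DIM('a)"
  have \<delta>: "0 < ?\<delta>"
    using \<open>0 < \<epsilon>\<close> by simp
  obtain B where B: "\<And>n. norm (letter_sum h w n) \<le> B"
    using bdd unfolding bounded_iff by auto
  have inner: "letter_sum (\<lambda>a. h a \<bullet> b) w n = letter_sum h w n \<bullet> b" for b n
    by (simp add: letter_sum_def inner_sum_left)
  have "\<exists>K. \<forall>p. (\<forall>i<K. w (p + i) = w i) \<longrightarrow> letter_sum h w p \<bullet> b < ?\<delta>" for b
  proof -
    have "letter_sum (\<lambda>a. h a \<bullet> b) w n \<le> B * norm b" for n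
      unfolding inner using norm_cauchy_schwarz[of "letter_sum h w n" b] B[of n]
      by (meson mult_right_mono norm_ge_zero order_trans)
    then have "bdd_above (range (letter_sum (\<lambda>a. h a \<bullet> b) w))"
      by (intro bdd_aboveI2)
    from letter_sum_return_less[OF this \<delta>] show ?thesis
      unfolding inner by blast
  qed
  then obtain K
    where K: "\<And>b p. (\<forall>i<K b. w (p + i) = w i) \<Longrightarrow> letter_sum h w p \<bullet> b < ?\<delta>"
    by metis
  let ?K = "Max (K ` (Basis \<union> uminus ` Basis))"
  have le: "K b \<le> ?K" "K (- b) \<le> ?K" if "b \<in> Basis" for b
    using that by (auto intro!: Max_ge)
  have "norm (letter_sum h w p) < \<epsilon>" if "\<And>i. i < ?K \<Longrightarrow> w (p + i) = w i" for p
  proof -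
    have "\<bar>letter_sum h w p \<bullet> b\<bar> < ?\<delta>" if "b \<in> Basis" for b
      using K[of b p] K[of "- b" p] le[OF that] \<open>\<And>i. i < ?K \<Longrightarrow> w (p + i) = w i\<close>
      by (auto simp: abs_less_iff)
    then have "(\<Sum>b\<in>Basis. \<bar>letter_sum h w p \<bullet> b\<bar>) < (\<Sum>b\<in>(Basis::'a set). ?\<delta>)"
      by (intro sum_strict_mono) auto
    then show ?thesis
      using norm_le_l1[of "letter_sum h w p"] by simp
  qed
  then show ?thesis
    using that by blast
qed

section \<open>Semicontinuity of letter sums before a given letter\<close>

text \<open>
  An occurrence in \<open>w\<close> of a prefix of \<open>x\<close> that is at least as long as the shared one is a return of \<open>w\<close>
  to itself, so the sums of \<open>x\<close> differ from sums of \<open>w\<close> by a small translation. The bound \<open>K\<close> is uniform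
  in \<open>x\<close> and \<open>n\<close>, although the translation depends on both.
\<close>

lemma letter_sums_upper_semicontinuous:
  fixes h :: "'d \<Rightarrow> 'a::euclidean_space"
  assumes bdd: "bounded (range (letter_sum h w))" and "0 < \<epsilon>"
  obtains K where "\<And>x n. x \<in> fullshift closure_of shift_orbit w \<Longrightarrow> (\<And>i. i < K \<Longrightarrow> x i = w i) \<Longrightarrow>
    \<exists>m. w m = x n \<and> dist (letter_sum h x n) (letter_sum h w m) < \<epsilon>"
proof -
  obtain K where K: "\<And>p. (\<And>i. i < K \<Longrightarrow> w (p + i) = w i) \<Longrightarrow> norm (letter_sum h w p) < \<epsilon>"
    using letter_sum_return_norm_less[OF assms] by blast
  have "\<exists>m. w m = x n \<and> dist (letter_sum h x n) (letter_sum h w m) < \<epsilon>"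
    if x: "x \<in> fullshift closure_of shift_orbit w" and agree: "\<And>i. i < K \<Longrightarrow> x i = w i" for x n
  proof -
    \<comment> \<open>Length \<open>K\<close> makes \<open>p\<close> a return of \<open>w\<close>; length \<open>Suc n\<close> includes the letter after the prefix.\<close>
    obtain p where p: "\<And>i. i < max K (Suc n) \<Longrightarrow> w (p + i) = x i"
      using orbit_closure_prefix_occurs[OF x] by blast
    have "norm (letter_sum h w p) < \<epsilon>"
      using p agree by (intro K) simp
    moreover have "letter_sum h w (p + n) = letter_sum h w p + letter_sum h x n"
      using p letter_sum_cong[of n "\<lambda>i. w (p + i)" x h] by (simp add: letter_sum_add)
    ultimately have "dist (letter_sum h x n) (letter_sum h w (p + n)) < \<epsilon>"
      by (simp add: dist_norm)
    moreover have "w (p + n) = x n"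
      using p by simp
    ultimately show ?thesis by blast
  qed
  then show ?thesis
    using that by blast
qed

text \<open>
  Sums of \<open>w\<close> over prefixes inside the shared one are sums of \<open>x\<close> as well. Compactness reduces the
  infinitely many sums of \<open>w\<close> to finitely many, for which one shared prefix is long enough.
\<close>

lemma letter_sums_lower_semicontinuous:
  fixes h :: "'d \<Rightarrow> 'a::euclidean_space"
  assumes bdd: "bounded (range (letter_sum h w))" and "0 < \<epsilon>"
  obtains K where "\<And>x m. (\<And>i. i < K \<Longrightarrow> x i = w i) \<Longrightarrow> w m = a \<Longrightarrow>
    \<exists>n. x n = a \<and> dist (letter_sum h x n) (letter_sum h w m) < \<epsilon>"
proof -
  let ?I = "{m. w m = a}"
  have "compact (closure (letter_sum h w ` ?I))"
    using bounded_subset[OF bdd] by (simp add: compact_closure image_mono)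
  moreover have "closure (letter_sum h w ` ?I) \<subseteq> (\<Union>m\<in>?I. ball (letter_sum h w m) \<epsilon>)"
    using \<open>0 < \<epsilon>\<close> by (auto simp: closure_approachable)
  ultimately obtain F where F: "F \<subseteq> ?I" "finite F"
      "closure (letter_sum h w ` ?I) \<subseteq> (\<Union>m\<in>F. ball (letter_sum h w m) \<epsilon>)"
    using compactE_image[of "closure (letter_sum h w ` ?I)" ?I "\<lambda>m. ball (letter_sum h w m) \<epsilon>"]
    by auto
  obtain K where K: "\<And>m. m \<in> F \<Longrightarrow> m < K"
    using F(2) finite_nat_set_iff_bounded by auto
  have "\<exists>n. x n = a \<and> dist (letter_sum h x n) (letter_sum h w m) < \<epsilon>"
    if agree: "\<And>i. i < K \<Longrightarrow> x i = w i" and m: "w m = a" for x m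
  proof -
    have "letter_sum h w m \<in> closure (letter_sum h w ` ?I)"
      using m by (intro subsetD[OF closure_subset] imageI) simp
    then obtain n where n: "n \<in> F" "dist (letter_sum h w n) (letter_sum h w m) < \<epsilon>"
      using F(3) by auto
    have "letter_sum h x n = letter_sum h w n"
      using K[OF n(1)] agree by (intro letter_sum_cong) auto
    moreover have "x n = a"
      using agree[OF K[OF n(1)]] n(1) F(1) by auto
    ultimately show ?thesis
      using n by auto
  qed
  then show ?thesis
    using that by blast
qed

section \<open>Convergence of Rauzy subtiles\<close>

lemma ennreal_tendsto_0I:
  fixes f :: "'b \<Rightarrow> ennreal"
  assumes "\<And>e. 0 < e \<Longrightarrow> \<forall>\<^sub>F n in F. f n \<le> ennreal e"
  shows "(f \<longlongrightarrow> 0) F"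
proof (rule order_tendstoI)
  fix b :: ennreal assume "0 < b"
  then obtain c where c: "0 < c" "c < b"
    using dense by blast
  then obtain e where "c = ennreal e" "0 < e"
    by (cases c) (auto simp: top.not_eq_extremum)
  then show "\<forall>\<^sub>F n in F. f n < b"
    using assms[of e] c by (auto elim: eventually_mono)
qed simp

theorem proposition3p8:
  fixes X :: "(nat \<Rightarrow> 'd::finite) set"
    and C :: real
    and w :: "nat \<Rightarrow> 'd"
    and ws :: "nat \<Rightarrow> nat \<Rightarrow> 'd"
    and H :: "(real ^ 'd) set"
    and N :: "real ^ 'd \<Rightarrow> real"
  assumes "subshift X"
    and "C \<ge> 1" and "\<forall>x\<in>X. balanced C x"
    and "subspace H" and "dim H = CARD('d) - 1" and "letter_frequencies X \<notin> H"
    and "norm_on H N"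
    and "\<forall>n. ws n \<in> X"
    and "limitin fullshift ws w sequentially"
    and "w \<in> X" and "X \<subseteq> fullshift closure_of shift_orbit w"
  shows "\<forall>a. (\<lambda>n. hausdorff_distance N
            (rauzy_subtile (letter_frequencies X) H a (ws n))
            (rauzy_subtile (letter_frequencies X) H a w)) \<longlonglongrightarrow> 0"
proof (intro allI ennreal_tendsto_0I)
  fix a :: 'd and e :: real
  assume "0 < e"
  define v where "v = letter_frequencies X"
  define \<pi> where "\<pi> = proj_along v H"
  define h :: "'d \<Rightarrow> real ^ 'd" where "h = (\<lambda>b. \<pi> (axis b 1))"
  have lin: "linear \<pi>" and \<pi>_H: "\<pi> y \<in> H" and \<pi>_v: "\<pi> v = 0"
    and \<pi>_id: "y \<in> H \<Longrightarrow> \<pi> y = y" for y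
    using proj_along_hyperplane[of H v] assms(4-6) by (simp_all add: \<pi>_def v_def)
  have \<pi>_sum: "\<pi> (abelianization (factor x 0 n)) = letter_sum h x n" for x n
    unfolding h_def by (rule linear_abelianization_factor[OF lin])
  have tile: "rauzy_subtile (letter_frequencies X) H a x = closure (letter_sum h x ` {n. x n = a})" for x
  proof -
    have "\<pi> ` prefix_points a x = letter_sum h x ` {n. x n = a}"
      unfolding prefix_points_def by (auto simp flip: \<pi>_sum)
    then show ?thesis
      by (simp add: rauzy_subtile_def \<pi>_def v_def)
  qed
  have bdd: "bounded (range (letter_sum h w))"
  proof -
    obtain B where B: "\<And>y. norm (\<pi> y) \<le> B * norm y" "0 < B"
      using linear_bounded_pos[OF lin] by blast
    have "norm (letter_sum h w n) \<le> B * (real CARD('d) * C)" for n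
    proof -
      \<comment> \<open>Subtracting \<open>n v\<close> leaves the projection unchanged and makes the vector bounded.\<close>
      let ?y = "abelianization (factor w 0 n) - real n *\<^sub>R v"
      have "norm ?y \<le> (\<Sum>b\<in>UNIV. \<bar>?y $ b\<bar>)"
        by (rule norm_le_l1_cart)
      also have "\<dots> \<le> real CARD('d) * C"
        using letter_frequencies_near_linear[OF \<open>w \<in> X\<close> _ assms(11), of C n] assms(3) \<open>w \<in> X\<close>
        by (intro sum_bounded_above[where K = C, simplified]) (simp add: abelianization_def v_def)
      finally have "norm (\<pi> ?y) \<le> B * (real CARD('d) * C)"
        using B by (smt (verit) mult_left_mono)
      moreover have "\<pi> ?y = letter_sum h w n"
        using \<pi>_v by (simp add: linear_diff[OF lin] linear_scale[OF lin] \<pi>_sum)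
      ultimately show ?thesis by simp
    qed
    then show ?thesis
      unfolding bounded_iff by blast
  qed
  obtain M where M: "0 < M" "\<And>y. y \<in> H \<Longrightarrow> N y \<le> M * norm y"
    using norm_on_le_norm[OF assms(4,7) lin \<pi>_H \<pi>_id] by blast
  \<comment> \<open>chosen so that the bound \<open>M * (2 * \<delta>)\<close> on the distance of the closures is \<open>e\<close>\<close>
  define \<delta> where "\<delta> = e / (2 * M)"
  have \<delta>: "0 < \<delta>" "M * (2 * \<delta>) = e"
    using \<open>0 < e\<close> M by (simp_all add: \<delta>_def)
  obtain K where K: "\<And>x n. x \<in> fullshift closure_of shift_orbit w \<Longrightarrow> (\<And>i. i < K \<Longrightarrow> x i = w i) \<Longrightarrow>
      \<exists>m. w m = x n \<and> dist (letter_sum h x n) (letter_sum h w m) < \<delta>"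
    using letter_sums_upper_semicontinuous[OF bdd \<delta>(1)] by metis
  obtain L where L: "\<And>x m. (\<And>i. i < L \<Longrightarrow> x i = w i) \<Longrightarrow> w m = a \<Longrightarrow>
      \<exists>n. x n = a \<and> dist (letter_sum h x n) (letter_sum h w m) < \<delta>"
    using letter_sums_lower_semicontinuous[OF bdd \<delta>(1)] by metis
  from limitin_fullshift_prefix[OF assms(9), of "max K L"]
  show "\<forall>\<^sub>F n in sequentially. hausdorff_distance N
      (rauzy_subtile (letter_frequencies X) H a (ws n))
      (rauzy_subtile (letter_frequencies X) H a w) \<le> ennreal e"
  proof eventually_elim
    case (elim k)
    have x: "ws k \<in> fullshift closure_of shift_orbit w"
      using assms(8,11) by blast
    have in_H: "letter_sum h x n \<in> H" for x n
      using \<pi>_H by (simp flip: \<pi>_sum)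
    show ?case
      unfolding tile \<delta>(2)[symmetric]
    proof (rule hausdorff_distance_closure_le[OF assms(4)])
      fix y assume "y \<in> letter_sum h (ws k) ` {n. ws k n = a}"
      then obtain n where n: "ws k n = a" "y = letter_sum h (ws k) n"
        by blast
      obtain m where "w m = a" "dist y (letter_sum h w m) < \<delta>"
        using K[OF x, of n] elim n by auto
      then show "\<exists>z\<in>letter_sum h w ` {n. w n = a}. dist y z \<le> \<delta>"
        by (intro bexI[of _ "letter_sum h w m"]) auto
    next
      fix z assume "z \<in> letter_sum h w ` {n. w n = a}"
      then obtain m where m: "w m = a" "z = letter_sum h w m"
        by blast
      obtain n where "ws k n = a" "dist (letter_sum h (ws k) n) z < \<delta>"
        using L[of "ws k" m] elim m by auto
      then show "\<exists>y\<in>letter_sum h (ws k) ` {n. ws k n = a}. dist y z \<le> \<delta>"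
        by (intro bexI[of _ "letter_sum h (ws k) n"]) auto
    qed (use in_H M \<delta> in auto)
  qed
qed

end
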